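(* Let $f$ be a manageable width function. There is a function $h$ such that for every hypergraph $H$, every rooted tree decomposition $\mathbf{t}=(T,\mathrm{bag})$ of $H$ and every elimination forest $F$ of $H$, every node $x\in V(T)$ has degree at most $h(\mathrm{split}(\mathbf{t},F),\mathrm{mir}(\mathbf{t},F),f\text{-width}(\mathbf{t}),\mathrm{rank}(H))$ in the stain intersection graph $\mathrm{SG}(\mathbf{t},F)$.
   Context: Hypergraph $H$: finite $V(H)$, edges non-empty subsets, each vertex in an edge; $\mathrm{rank}(H)$ = max edge size; $H[U]$ has edges $\{e\cap U\ne\emptyset\}$; disjoint sets are non-adjacent if no edge meets both. Manageable width function $f$ (values $f_H(U)\ge0$): weakly additive on disjoint non-adjacent sets; there is computable $\beta$ with $f_H(U)\le k\Rightarrow|U|\le\beta(k,\mathrm{rank}(H))$; $H_1[U_1]\cong H_2[U_2]\Rightarrow f_{H_1}(U_1)=f_{H_2}(U_2)$; $f_H(V(H))$ computable in time bounded by a function of $|V(H)|$. A rooted tree decomposition $\mathbf{t}=(T,\mathrm{bag})$: rooted tree, bags covering every edge, each vertex's bags forming a connected subtree; $f\text{-width}(\mathbf{t})=\max_x f_H(\mathrm{bag}(x))$. $\mathrm{adh}(x)=\mathrm{bag}(x)\cap\mathrm{bag}(\text{parent})$ ($\emptyset$ at root), $\mathrm{mrg}(x)=\mathrm{bag}(x)\setminus\mathrm{adh}(x)$, $\mathrm{cmp}(x)=\bigcup_{y\text{ descendant of }x}\mathrm{mrg}(y)$; $\mathrm{mn}(u)$ is the unique node with $u\in\mathrm{mrg}(\mathrm{mn}(u))$.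 Elimination forest $F$: rooted forest on $V(H)$ where vertices of a common edge are in ancestor–descendant relation. Factors ($F_x$ = descendants of $x$ incl. $x$): tree factor $F_x$; forest factor = non-empty union of tree factors with sibling roots; context factor = $F_x\setminus B$, $B$ a forest factor with roots strict descendants of $x$. $\mathrm{MF}(U)$ = inclusion-maximal factors inside $U$; $U$ well-formed if $\mathrm{MF}(U)$ has no context factor. $\mathrm{split}(\mathbf{t},F)=\max_x|\mathrm{MF}(\mathrm{cmp}(x))|$; $\mathrm{mir}(\mathbf{t},F)$ = max over $x$ of the number of children $y$ of $x$ with $\mathrm{cmp}(y)$ not well-formed. $\mathrm{Stain}(u)=\{\mathrm{mn}(u)\}\cup\bigcup_{v\text{ child of }u\text{ in }F}$ (vertices of the $T$-path from $\mathrm{mn}(u)$ to $\mathrm{mn}(v)$). $\mathrm{SG}(\mathbf{t},F)$ is the bipartite graph with parts $V(T)$ and $V(H)$, where $x\in V(T)$ is adjacent to $u\in V(H)$ iff $x\in\mathrm{Stain}(u)$. *)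

theory Defs
  imports Complex_Main "HOL-Library.Nat_Bijection"
begin

section \<open>Hypergraphs\<close>

record 'v hypergraph =
  hverts :: "'v set"
  hedges :: "'v set set"

definition hypergraph :: "'v hypergraph \<Rightarrow> bool" where
  "hypergraph H \<longleftrightarrow> finite (hverts H) \<and> (\<forall>e\<in>hedges H. e \<noteq> {} \<and> e \<subseteq> hverts H)
     \<and> (\<forall>v\<in>hverts H. \<exists>e\<in>hedges H. v \<in> e)"

text \<open>The rank of the empty hypergraph is 0.\<close>

definition rank :: "'v hypergraph \<Rightarrow> nat" where
  "rank H = Max (insert 0 (card ` hedges H))"

definition induced :: "'v hypergraph \<Rightarrow> 'v set \<Rightarrow> 'v hypergraph" where
  "induced H U = \<lparr>hverts = U, hedges = {e \<inter> U | e. e \<in> hedges H \<and> e \<inter> U \<noteq> {}}\<rparr>"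

definition hypergraph_iso :: "'v hypergraph \<Rightarrow> 'v hypergraph \<Rightarrow> bool" where
  "hypergraph_iso H1 H2 \<longleftrightarrow>
     (\<exists>\<phi>. bij_betw \<phi> (hverts H1) (hverts H2) \<and> (\<lambda>e. \<phi> ` e) ` hedges H1 = hedges H2)"

definition nonadjacent :: "'v hypergraph \<Rightarrow> 'v set \<Rightarrow> 'v set \<Rightarrow> bool" where
  "nonadjacent H U1 U2 \<longleftrightarrow> \<not> (\<exists>e\<in>hedges H. e \<inter> U1 \<noteq> {} \<and> e \<inter> U2 \<noteq> {})"


section \<open>Computability\<close>

text \<open>
  The model of computation is the Minsky register machine. \<open>Dec r l\<close> jumps to \<open>l\<close> if register
  \<open>r\<close> is zero and otherwise decrements \<open>r\<close> and proceeds to the next instruction. The machine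
  halts when the program counter leaves the program.
\<close>

datatype instr = Inc nat | Dec nat nat

definition step :: "instr list \<Rightarrow> nat \<times> (nat \<Rightarrow> nat) \<Rightarrow> nat \<times> (nat \<Rightarrow> nat)" where
  "step P = (\<lambda>(pc, R).
     if pc < length P then
       (case P ! pc of
          Inc r \<Rightarrow> (Suc pc, R(r := Suc (R r)))
        | Dec r l \<Rightarrow> (if R r = 0 then (l, R) else (Suc pc, R(r := R r - 1))))
     else (pc, R))"

text \<open>
  On inputs \<open>xs\<close>, placed in the first registers, \<open>P\<close> halts after at most \<open>t\<close> steps with output
  \<open>m\<close> in register 0 (halting configurations are fixed points of \<open>step\<close>).
\<close>

definition computes_within :: "instr list \<Rightarrow> nat list \<Rightarrow> nat \<Rightarrow> nat \<Rightarrow> bool" where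
  "computes_within P xs t m \<longleftrightarrow>
     (case (step P ^^ t) (0, \<lambda>i. if i < length xs then xs ! i else 0) of
        (pc, R) \<Rightarrow> length P \<le> pc \<and> R 0 = m)"

definition computable2 :: "(nat \<Rightarrow> nat \<Rightarrow> nat) \<Rightarrow> bool" where
  "computable2 \<beta> \<longleftrightarrow> (\<exists>P. \<forall>k r. \<exists>t. computes_within P [k, r] t (\<beta> k r))"

text \<open>
  A hypergraph is presented to a machine by its number of vertices and the code of its edge set,
  relative to a numbering \<open>g\<close> of its vertices; the machine must succeed for every numbering.
  The size of the input is then bounded in terms of the number of vertices.
\<close>

definition edge_code :: "('v \<Rightarrow> nat) \<Rightarrow> 'v hypergraph \<Rightarrow> nat" where
  "edge_code g H = set_encode ((\<lambda>e. set_encode (g ` e)) ` hedges H)"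

text \<open>
  The values are real numbers, so computing one means computing, for every requested precision
  \<open>n\<close>, a dyadic rational at distance at most \<open>1 / 2 ^ n\<close> from it. In particular this covers
  algorithms with exact rational output, for which the running time does not depend on \<open>n\<close>
  except through the rounding.
\<close>

definition total_value_computable :: "('v hypergraph \<Rightarrow> 'v set \<Rightarrow> real) \<Rightarrow> bool" where
  "total_value_computable f \<longleftrightarrow>
     (\<exists>P (\<tau> :: nat \<Rightarrow> nat \<Rightarrow> nat). \<forall>H g n.
        hypergraph H \<longrightarrow> bij_betw g (hverts H) {..<card (hverts H)} \<longrightarrow>
        (\<exists>m. computes_within P [card (hverts H), edge_code g H, n] (\<tau> (card (hverts H)) n) m
             \<and> \<bar>f H (hverts H) - real m / 2 ^ n\<bar> \<le> 1 / 2 ^ n))"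


section \<open>Manageable width functions\<close>

text \<open>\<open>f H U\<close> is only meaningful when \<open>H\<close> is a hypergraph and \<open>U \<subseteq> hverts H\<close>.\<close>

definition manageable :: "('v hypergraph \<Rightarrow> 'v set \<Rightarrow> real) \<Rightarrow> bool" where
  "manageable f \<longleftrightarrow>
     (\<forall>H U. hypergraph H \<longrightarrow> U \<subseteq> hverts H \<longrightarrow> 0 \<le> f H U) \<and>
     (\<forall>H U1 U2. hypergraph H \<longrightarrow> U1 \<subseteq> hverts H \<longrightarrow> U2 \<subseteq> hverts H \<longrightarrow>
        U1 \<inter> U2 = {} \<longrightarrow> nonadjacent H U1 U2 \<longrightarrow> f H (U1 \<union> U2) = f H U1 + f H U2) \<and>
     (\<exists>\<beta>. computable2 \<beta> \<and>
        (\<forall>H U k. hypergraph H \<longrightarrow> U \<subseteq> hverts H \<longrightarrow> f H U \<le> real k \<longrightarrow> card U \<le> \<beta> k (rank H))) \<and>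
     (\<forall>H1 H2 U1 U2. hypergraph H1 \<longrightarrow> hypergraph H2 \<longrightarrow>
        U1 \<subseteq> hverts H1 \<longrightarrow> U2 \<subseteq> hverts H2 \<longrightarrow>
        hypergraph_iso (induced H1 U1) (induced H2 U2) \<longrightarrow> f H1 U1 = f H2 U2) \<and>
     total_value_computable f"


section \<open>Rooted forests\<close>

text \<open>\<open>(y, x) \<in> parent T\<close> means that \<open>x\<close> is the parent of \<open>y\<close>.\<close>

record 'a rforest =
  nodes :: "'a set"
  parent :: "('a \<times> 'a) set"

definition rooted_forest :: "'a rforest \<Rightarrow> bool" where
  "rooted_forest T \<longleftrightarrow> finite (nodes T) \<and> parent T \<subseteq> nodes T \<times> nodes T
     \<and> single_valued (parent T) \<and> acyclic (parent T)"

definition rooted_tree :: "'a rforest \<Rightarrow> bool" where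
  "rooted_tree T \<longleftrightarrow> rooted_forest T \<and> (\<exists>!r. r \<in> nodes T \<and> r \<notin> Domain (parent T))"

definition children :: "'a rforest \<Rightarrow> 'a \<Rightarrow> 'a set" where
  "children T x = {y. (y, x) \<in> parent T}"

definition descendants :: "'a rforest \<Rightarrow> 'a \<Rightarrow> 'a set" where
  "descendants T x = {y \<in> nodes T. (y, x) \<in> (parent T)\<^sup>*}"

definition adj :: "'a rforest \<Rightarrow> ('a \<times> 'a) set" where
  "adj T = parent T \<union> (parent T)\<inverse>"

definition connected_in :: "'a rforest \<Rightarrow> 'a set \<Rightarrow> bool" where
  "connected_in T S \<longleftrightarrow> (\<forall>x\<in>S. \<forall>y\<in>S. (x, y) \<in> (Restr (adj T) S)\<^sup>*)"

definition is_path :: "'a rforest \<Rightarrow> 'a list \<Rightarrow> bool" where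
  "is_path T p \<longleftrightarrow> p \<noteq> [] \<and> set p \<subseteq> nodes T \<and> distinct p
     \<and> successively (\<lambda>x y. (x, y) \<in> adj T) p"

text \<open>In a tree there is exactly one path between two given nodes.\<close>

definition path_nodes :: "'a rforest \<Rightarrow> 'a \<Rightarrow> 'a \<Rightarrow> 'a set" where
  "path_nodes T a b = {z. \<exists>p. is_path T p \<and> hd p = a \<and> last p = b \<and> z \<in> set p}"


section \<open>Rooted tree decompositions\<close>

definition tree_decomposition :: "'v hypergraph \<Rightarrow> 't rforest \<Rightarrow> ('t \<Rightarrow> 'v set) \<Rightarrow> bool" where
  "tree_decomposition H T bag \<longleftrightarrow> rooted_tree T
     \<and> (\<forall>x\<in>nodes T. bag x \<subseteq> hverts H)
     \<and> (\<forall>e\<in>hedges H. \<exists>x\<in>nodes T. e \<subseteq> bag x)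
     \<and> (\<forall>v\<in>hverts H. connected_in T {x \<in> nodes T. v \<in> bag x})"

definition fwidth ::
  "('v hypergraph \<Rightarrow> 'v set \<Rightarrow> real) \<Rightarrow> 'v hypergraph \<Rightarrow> 't rforest \<Rightarrow> ('t \<Rightarrow> 'v set) \<Rightarrow> real" where
  "fwidth f H T bag = Max ((\<lambda>x. f H (bag x)) ` nodes T)"

definition adh :: "'t rforest \<Rightarrow> ('t \<Rightarrow> 'v set) \<Rightarrow> 't \<Rightarrow> 'v set" where
  "adh T bag x = bag x \<inter> (\<Union>p\<in>parent T `` {x}. bag p)"

definition mrg :: "'t rforest \<Rightarrow> ('t \<Rightarrow> 'v set) \<Rightarrow> 't \<Rightarrow> 'v set" where
  "mrg T bag x = bag x - adh T bag x"

definition cmp :: "'t rforest \<Rightarrow> ('t \<Rightarrow> 'v set) \<Rightarrow> 't \<Rightarrow> 'v set" where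
  "cmp T bag x = (\<Union>y\<in>descendants T x. mrg T bag y)"

definition mn :: "'t rforest \<Rightarrow> ('t \<Rightarrow> 'v set) \<Rightarrow> 'v \<Rightarrow> 't" where
  "mn T bag u = (THE x. x \<in> nodes T \<and> u \<in> mrg T bag x)"


section \<open>Elimination forests and factors\<close>

definition elimination_forest :: "'v hypergraph \<Rightarrow> 'v rforest \<Rightarrow> bool" where
  "elimination_forest H F \<longleftrightarrow> rooted_forest F \<and> nodes F = hverts H
     \<and> (\<forall>e\<in>hedges H. \<forall>u\<in>e. \<forall>v\<in>e. u \<in> descendants F v \<or> v \<in> descendants F u)"

text \<open>The roots of a forest count as siblings of each other.\<close>

definition siblings :: "'v rforest \<Rightarrow> 'v set \<Rightarrow> bool" where
  "siblings F S \<longleftrightarrow> S \<subseteq> nodes F \<and> (\<forall>x\<in>S. \<forall>y\<in>S. parent F `` {x} = parent F `` {y})"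

definition tree_factor :: "'v rforest \<Rightarrow> 'v set \<Rightarrow> bool" where
  "tree_factor F A \<longleftrightarrow> (\<exists>x\<in>nodes F. A = descendants F x)"

definition forest_factor_at :: "'v rforest \<Rightarrow> 'v set \<Rightarrow> 'v set \<Rightarrow> bool" where
  "forest_factor_at F S A \<longleftrightarrow> S \<noteq> {} \<and> siblings F S \<and> A = (\<Union>x\<in>S. descendants F x)"

definition forest_factor :: "'v rforest \<Rightarrow> 'v set \<Rightarrow> bool" where
  "forest_factor F A \<longleftrightarrow> (\<exists>S. forest_factor_at F S A)"

definition context_factor :: "'v rforest \<Rightarrow> 'v set \<Rightarrow> bool" where
  "context_factor F A \<longleftrightarrow> (\<exists>x\<in>nodes F. \<exists>S B.
     forest_factor_at F S B \<and> S \<subseteq> descendants F x - {x} \<and> A = descendants F x - B)"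

definition factor :: "'v rforest \<Rightarrow> 'v set \<Rightarrow> bool" where
  "factor F A \<longleftrightarrow> tree_factor F A \<or> forest_factor F A \<or> context_factor F A"

definition MF :: "'v rforest \<Rightarrow> 'v set \<Rightarrow> 'v set set" where
  "MF F U = {A. factor F A \<and> A \<subseteq> U \<and> \<not> (\<exists>B. factor F B \<and> B \<subseteq> U \<and> A \<subset> B)}"

definition well_formed :: "'v rforest \<Rightarrow> 'v set \<Rightarrow> bool" where
  "well_formed F U \<longleftrightarrow> \<not> (\<exists>A\<in>MF F U. context_factor F A)"

definition split :: "'t rforest \<Rightarrow> ('t \<Rightarrow> 'v set) \<Rightarrow> 'v rforest \<Rightarrow> nat" where
  "split T bag F = Max ((\<lambda>x. card (MF F (cmp T bag x))) ` nodes T)"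

definition mir :: "'t rforest \<Rightarrow> ('t \<Rightarrow> 'v set) \<Rightarrow> 'v rforest \<Rightarrow> nat" where
  "mir T bag F =
     Max ((\<lambda>x. card {y \<in> children T x. \<not> well_formed F (cmp T bag y)}) ` nodes T)"


section \<open>The stain intersection graph\<close>

definition Stain :: "'t rforest \<Rightarrow> ('t \<Rightarrow> 'v set) \<Rightarrow> 'v rforest \<Rightarrow> 'v \<Rightarrow> 't set" where
  "Stain T bag F u =
     {mn T bag u} \<union> (\<Union>v\<in>children F u. path_nodes T (mn T bag u) (mn T bag v))"

record 'a ugraph =
  gverts :: "'a set"
  gedges :: "'a set set"

definition degree :: "'a ugraph \<Rightarrow> 'a \<Rightarrow> nat" where
  "degree G x = card {e \<in> gedges G. x \<in> e}"

definition SG ::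
  "'v hypergraph \<Rightarrow> 't rforest \<Rightarrow> ('t \<Rightarrow> 'v set) \<Rightarrow> 'v rforest \<Rightarrow> ('t + 'v) ugraph" where
  "SG H T bag F =
     \<lparr>gverts = Inl ` nodes T \<union> Inr ` hverts H,
      gedges = {{Inl x, Inr u} | x u. x \<in> nodes T \<and> u \<in> hverts H \<and> x \<in> Stain T bag F u}\<rparr>"

end

(*
  Suppose x lies on the path from mn u to mn v, where v is a child of u in F. Unless u or v is
  in bag x, deleting x separates mn u from mn v, so either exactly one of u, v is in cmp x, or
  u is in cmp y and v is not for some child y of x. In both cases the edge uv of F crosses the
  boundary of such a component. Every factor has at most two vertices u with a crossing edge to a
  child (the parent of its roots, and the parent of the roots cut out of a context factor), so a
  component has at most 2 * split of them. In the second case cmp y is not closed under taking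
  children, so it is not well-formed, and at most mir children y are concerned.
*)
theory Submission
  imports Defs
begin

section \<open>Descendants in rooted forests\<close>

lemma descendants_refl: "x \<in> nodes T \<Longrightarrow> x \<in> descendants T x"
  by (simp add: descendants_def)

lemma rooted_forest_nodes:
  assumes "rooted_forest T" "(y, x) \<in> parent T"
  shows "y \<in> nodes T" "x \<in> nodes T"
  using assms by (auto simp: rooted_forest_def)

lemma descendants_child:
  assumes "rooted_forest T" "w \<in> descendants T x" "(v, w) \<in> parent T"
  shows "v \<in> descendants T x"
  using assms rooted_forest_nodes[OF assms(1,3)]
  by (auto simp: descendants_def intro: converse_rtrancl_into_rtrancl)

text \<open>The chain from \<open>v\<close> up to \<open>x\<close> is nonempty, and its first step
  must go to \<open>w\<close> because parents are unique.\<close>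

lemma descendants_parent:
  assumes "rooted_forest T" "v \<in> descendants T x" "(v, w) \<in> parent T" "v \<noteq> x"
  shows "w \<in> descendants T x"
proof -
  have "(v, x) \<in> (parent T)\<^sup>*" using assms by (simp add: descendants_def)
  then obtain w' where "(v, w') \<in> parent T" "(w', x) \<in> (parent T)\<^sup>*"
    using assms(4) by (metis converse_rtranclE)
  then show ?thesis
    using assms(1,3) rooted_forest_nodes[OF assms(1,3)]
    by (auto simp: descendants_def rooted_forest_def dest: single_valuedD)
qed

lemma descendants_antisym:
  assumes "rooted_forest T" "x \<in> descendants T y" "y \<in> descendants T x"
  shows "x = y"
proof -
  have "(x, y) \<in> (parent T)\<^sup>*" "(y, x) \<in> (parent T)\<^sup>*"
    using assms by (simp_all add: descendants_def)
  then show ?thesis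
    using assms(1) acyclic_impl_antisym_rtrancl[of "parent T"]
    by (auto simp: rooted_forest_def dest: antisymD)
qed

lemma not_descendant_of_child:
  assumes "rooted_forest T" "(y, x) \<in> parent T"
  shows "x \<notin> descendants T y"
proof
  assume "x \<in> descendants T y"
  then have "(y, y) \<in> (parent T)\<^sup>+"
    using assms(2) by (auto simp: descendants_def intro: rtrancl_into_trancl2)
  then show False using assms(1) by (simp add: rooted_forest_def acyclic_def)
qed

lemma strict_descendant_via_child:
  assumes "rooted_forest T" "w \<in> descendants T x" "w \<noteq> x"
  obtains y where "y \<in> children T x" "w \<in> descendants T y"
proof -
  have "(w, x) \<in> (parent T)\<^sup>*" using assms by (simp add: descendants_def)
  then obtain y where "(w, y) \<in> (parent T)\<^sup>*" "(y, x) \<in> parent T"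
    using assms(3) by (metis rtranclE)
  then show thesis
    using assms(2) that by (auto simp: children_def descendants_def)
qed

section \<open>Paths and the subtrees they enter or leave\<close>

lemma successively_crossing:
  assumes "successively R p" "p \<noteq> []" "P (hd p)" "\<not> P (last p)"
  shows "\<exists>a\<in>set p. \<exists>b\<in>set p. R a b \<and> P a \<and> \<not> P b"
  using assms
proof (induction p)
  case (Cons a p)
  show ?case
  proof (cases "p = [] \<or> \<not> P (hd p)")
    case True
    then have "p \<noteq> []" "R a (hd p)" "P a" "\<not> P (hd p)"
      using Cons.prems by (auto simp: successively_Cons)
    then show ?thesis by (meson hd_in_set list.set_intros)
  next
    case False
    then show ?thesis using Cons by (auto simp: successively_Cons)
  qed
qed simp

text \<open>A subtree is closed under children and, except at its top, under parents; so the only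
  way out is the edge above \<open>y\<close>.\<close>

lemma adj_descendants_crossing:
  assumes T: "rooted_forest T" and ab: "(a, b) \<in> adj T"
    and "a \<in> descendants T y" "b \<notin> descendants T y"
  shows "a = y \<and> (y, b) \<in> parent T"
  using assms(2-) descendants_child[OF T] descendants_parent[OF T] unfolding adj_def by blast

text \<open>A path without repetitions cannot use the edge above \<open>y\<close> twice. This is the
  separation property of trees, applied later with \<open>y\<close> a node \<open>x\<close> on the
  path and with \<open>y\<close> a child of \<open>x\<close>.\<close>

lemma path_nodes_descendants:
  assumes T: "rooted_forest T" and z: "z \<in> path_nodes T a b"
    and ab: "a \<in> descendants T y \<longleftrightarrow> b \<in> descendants T y"
  shows "z \<in> descendants T y \<longleftrightarrow> a \<in> descendants T y"
proof (rule ccontr)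
  assume neq: "\<not> ?thesis"
  let ?R = "\<lambda>x y. (x, y) \<in> adj T"
  obtain p where p: "is_path T p" "hd p = a" "last p = b" "z \<in> set p"
    using z by (auto simp: path_nodes_def)
  then obtain p1 p2 where pp: "p = p1 @ z # p2" by (meson split_list)
  have d: "distinct p" and s: "successively ?R p" using p(1) by (auto simp: is_path_def)
  have s1: "successively ?R (p1 @ [z])" and s2: "successively ?R (z # p2)"
    using s unfolding pp by (auto simp: successively_append_iff)
  have sym: "(u, v) \<in> adj T \<Longrightarrow> (v, u) \<in> adj T" for u v by (auto simp: adj_def)
  have hd1: "hd (p1 @ [z]) = a" using p(2) by (cases p1) (simp_all add: pp)
  have last2: "last (z # p2) = b" using p(3) by (simp add: pp)
  \<comment> \<open>Both halves of the path use the edge from \<open>y\<close> to its parent, so they share its endpoint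
    on the side not containing \<open>z\<close>.\<close>
  show False
  proof (cases "a \<in> descendants T y")
    case True
    then have zD: "z \<notin> descendants T y" and bD: "b \<in> descendants T y" using neq ab by auto
    have "\<exists>c\<in>set (p1 @ [z]). \<exists>d\<in>set (p1 @ [z]).
        ?R c d \<and> c \<in> descendants T y \<and> d \<notin> descendants T y"
      using successively_crossing[OF s1, of "\<lambda>w. w \<in> descendants T y"] True zD hd1 by simp
    then have "y \<in> set (p1 @ [z])" "y \<in> descendants T y"
      using adj_descendants_crossing[OF T] by metis+
    then have y1: "y \<in> set p1" using zD by auto
    have "\<exists>c\<in>set (z # p2). \<exists>d\<in>set (z # p2).
        ?R c d \<and> c \<notin> descendants T y \<and> \<not> d \<notin> descendants T y"
      using successively_crossing[OF s2, of "\<lambda>w. w \<notin> descendants T y"] bD zD last2 by simp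
    then have "y \<in> set (z # p2)"
      using adj_descendants_crossing[OF T] sym by metis
    then have "y \<in> set p2" using zD \<open>y \<in> descendants T y\<close> by auto
    then show False using d y1 by (auto simp: pp)
  next
    case False
    then have zD: "z \<in> descendants T y" and bD: "b \<notin> descendants T y" using neq ab by auto
    obtain q1 c where c: "q1 \<in> set (p1 @ [z])" "?R q1 c"
      "q1 \<notin> descendants T y" "c \<in> descendants T y"
      using successively_crossing[OF s1, of "\<lambda>w. w \<notin> descendants T y"] False zD hd1 by auto
    have q1: "q1 \<in> set p1" "(y, q1) \<in> parent T"
      using c zD adj_descendants_crossing[OF T sym[OF c(2)] c(4,3)] by auto
    have "\<exists>c\<in>set (z # p2). \<exists>d\<in>set (z # p2).
        ?R c d \<and> c \<in> descendants T y \<and> d \<notin> descendants T y"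
      using successively_crossing[OF s2, of "\<lambda>w. w \<in> descendants T y"] bD zD last2 by simp
    then obtain q2 where q2: "q2 \<in> set p2" "(y, q2) \<in> parent T"
      using adj_descendants_crossing[OF T] zD by (metis set_ConsD)
    have "q1 = q2"
      using T q1 q2 by (auto simp: rooted_forest_def dest: single_valuedD)
    then show False using d q1 q2 by (auto simp: pp)
  qed
qed

section \<open>Edges of the elimination forest crossing the boundary of a factor\<close>

text \<open>Upper ends of crossing edges are collected rather than the edges: a forest factor may
  have any number of roots, and hence of crossing edges, but these all share one upper end. Stains
  are also indexed by the upper end.\<close>

definition boundary_parents :: "'a rforest \<Rightarrow> 'a set \<Rightarrow> 'a set" where
  "boundary_parents F U = {u. \<exists>v\<in>children F u. (u \<in> U) \<noteq> (v \<in> U)}"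

lemma forest_factor_at_children:
  assumes "rooted_forest F" "forest_factor_at F S A" "u \<in> A" "v \<in> children F u"
  shows "v \<in> A"
  using assms descendants_child[OF assms(1)] by (auto simp: forest_factor_at_def children_def)

lemma forest_factor_at_tree: "x \<in> nodes F \<Longrightarrow> forest_factor_at F {x} (descendants F x)"
  by (auto simp: forest_factor_at_def siblings_def)

text \<open>A tree factor is a forest factor with a single root, so two cases suffice.\<close>

lemma factor_cases:
  assumes "factor F A"
  obtains (cutout) "context_factor F A" | (forest) S where "forest_factor_at F S A"
proof -
  have "\<exists>S. forest_factor_at F S A" if "tree_factor F A"
    using that by (auto simp: tree_factor_def dest: forest_factor_at_tree)
  then show thesis
    using assms cutout forest unfolding factor_def forest_factor_def by blast
qed

text \<open>A forest factor is closed under children, so a crossing edge enters it from above, at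
  one of its roots; the roots are siblings and have the same parent, if any.\<close>

lemma boundary_parents_forest_factor_at:
  assumes F: "rooted_forest F" and A: "forest_factor_at F S A"
  shows "\<exists>w. boundary_parents F A \<subseteq> {w}"
proof -
  have sv: "single_valued (parent F)" using F by (simp add: rooted_forest_def)
  have *: "\<exists>s\<in>S. (s, u) \<in> parent F" if u: "u \<in> boundary_parents F A" for u
  proof -
    obtain v where v: "(v, u) \<in> parent F" "u \<notin> A" "v \<in> A"
      using u forest_factor_at_children[OF F A]
      unfolding boundary_parents_def children_def by blast
    then obtain s where s: "s \<in> S" "v \<in> descendants F s" "u \<notin> descendants F s"
      using A by (auto simp: forest_factor_at_def)
    then have "v = s" using descendants_parent[OF F] v(1) by metis
    then show ?thesis using s v by auto
  qed
  have "u = u'" if u: "u \<in> boundary_parents F A" "u' \<in> boundary_parents F A" for u u'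
  proof -
    obtain s s' where s: "s \<in> S" "(s, u) \<in> parent F" "s' \<in> S" "(s', u') \<in> parent F"
      using *[OF u(1)] *[OF u(2)] by blast
    then have "parent F `` {s} = parent F `` {s'}"
      using A s(1,3) unfolding forest_factor_at_def siblings_def by blast
    then have "(s, u') \<in> parent F" using s(4) by (metis Image_singleton_iff)
    then show ?thesis using s(2) sv by (simp add: single_valuedD)
  qed
  then show ?thesis by blast
qed

text \<open>An edge crossing a difference of two sets crosses one of the two. A context factor is a
  tree factor minus a forest factor, and each of these contributes at most one upper end.\<close>

lemma boundary_parents_factor:
  assumes F: "rooted_forest F" and A: "factor F A"
  shows "card (boundary_parents F A) \<le> 2"
proof -
  have "\<exists>w w'. boundary_parents F A \<subseteq> {w, w'}"
  using A proof (cases rule: factor_cases)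
    case cutout
    then obtain x S B where x: "x \<in> nodes F" and B: "forest_factor_at F S B"
      and AB: "A = descendants F x - B" by (auto simp: context_factor_def)
    have "boundary_parents F A
        \<subseteq> boundary_parents F B \<union> boundary_parents F (descendants F x)"
      using forest_factor_at_children[OF F B]
        forest_factor_at_children[OF F forest_factor_at_tree[OF x]]
      by (auto simp: boundary_parents_def AB)
    moreover obtain w w' where "boundary_parents F B \<subseteq> {w}"
      "boundary_parents F (descendants F x) \<subseteq> {w'}"
      using boundary_parents_forest_factor_at[OF F]
        B forest_factor_at_tree[OF x] by metis
    ultimately show ?thesis by blast
  next
    case forest
    then show ?thesis using boundary_parents_forest_factor_at[OF F] by blast
  qed
  then obtain w w' where "boundary_parents F A \<subseteq> {w, w'}" by blast
  then have "card (boundary_parents F A) \<le> card {w, w'}" by (intro card_mono) auto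
  also have "\<dots> \<le> 2" by (simp add: card_insert_if)
  finally show ?thesis .
qed

section \<open>Maximal factors inside a vertex set\<close>

text \<open>A leaf is a tree factor; any other vertex is the context factor left after cutting off
  the subtrees of all its children. Hence every vertex of a set lies in some factor inside
  it.\<close>

lemma factor_singleton:
  assumes F: "rooted_forest F" and u: "u \<in> nodes F"
  shows "factor F {u}"
proof (cases "children F u = {}")
  case True
  then have "descendants F u = {u}"
    using strict_descendant_via_child[OF F, of _ u] descendants_refl[OF u] by blast
  then show ?thesis using u by (auto simp: factor_def tree_factor_def)
next
  case False
  let ?S = "children F u"
  let ?B = "\<Union>y\<in>?S. descendants F y"
  have "forest_factor_at F ?S ?B"
    using False F rooted_forest_nodes[OF F]
    by (auto simp: forest_factor_at_def siblings_def children_def rooted_forest_def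
        dest: single_valuedD)
  moreover have S: "?S \<subseteq> descendants F u - {u}"
    using descendants_child[OF F descendants_refl[OF u]] not_descendant_of_child[OF F]
      descendants_refl[OF u] by (auto simp: children_def)
  moreover have "{u} = descendants F u - ?B"
  proof (rule set_eqI)
    fix w show "w \<in> {u} \<longleftrightarrow> w \<in> descendants F u - ?B"
      using strict_descendant_via_child[OF F, of w u] descendants_refl[OF u]
        not_descendant_of_child[OF F, of _ u] by (auto simp: children_def)
  qed
  ultimately show ?thesis using u unfolding factor_def context_factor_def by blast
qed

lemma MF_covers:
  assumes F: "rooted_forest F" and U: "U \<subseteq> nodes F" and u: "u \<in> U"
  obtains A where "A \<in> MF F U" "u \<in> A"
proof -
  let ?C = "{A. factor F A \<and> A \<subseteq> U \<and> u \<in> A}"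
  have "finite U" using F U by (auto simp: rooted_forest_def intro: finite_subset)
  then have "finite ?C" by (auto intro: finite_subset[of _ "Pow U"])
  moreover have "{u} \<in> ?C" using factor_singleton[OF F] U u by auto
  ultimately obtain A where "A \<in> ?C" "\<forall>B\<in>?C. A \<subseteq> B \<longrightarrow> A = B"
    using finite_has_maximal[of ?C] by blast
  \<comment> \<open>Maximality among the factors containing \<open>u\<close> is enough, since every
    factor above \<open>A\<close> contains \<open>u\<close> as well.\<close>
  then have "A \<in> MF F U" "u \<in> A" by (auto simp: MF_def)
  then show thesis by (rule that)
qed

lemma finite_boundary_parents:
  assumes "rooted_forest F"
  shows "finite (boundary_parents F U)"
proof (rule finite_subset)
  show "boundary_parents F U \<subseteq> nodes F"
    using rooted_forest_nodes[OF assms] by (auto simp: boundary_parents_def children_def)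
qed (use assms in \<open>simp add: rooted_forest_def\<close>)

text \<open>The end of a crossing edge that is in \<open>U\<close> lies in some maximal factor; the
  other end is outside \<open>U\<close>, hence outside that factor. So the edge already crosses the
  factor, which accounts for at most two upper ends.\<close>

lemma card_boundary_parents_le:
  assumes F: "rooted_forest F" and U: "U \<subseteq> nodes F"
  shows "card (boundary_parents F U) \<le> 2 * card (MF F U)"
proof -
  have "finite U" using F U by (auto simp: rooted_forest_def intro: finite_subset)
  then have fin: "finite (MF F U)" by (auto simp: MF_def intro: finite_subset[of _ "Pow U"])
  have "boundary_parents F U \<subseteq> (\<Union>A\<in>MF F U. boundary_parents F A)"
  proof
    fix u assume "u \<in> boundary_parents F U"
    then obtain v where v: "v \<in> children F u" "(u \<in> U) \<noteq> (v \<in> U)"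
      by (auto simp: boundary_parents_def)
    then obtain A where "A \<in> MF F U" "u \<in> A \<or> v \<in> A" using MF_covers[OF F U] by metis
    moreover from this have "A \<subseteq> U" by (simp add: MF_def)
    ultimately show "u \<in> (\<Union>A\<in>MF F U. boundary_parents F A)"
      using v by (auto simp: boundary_parents_def)
  qed
  then have "card (boundary_parents F U) \<le> card (\<Union>A\<in>MF F U. boundary_parents F A)"
    by (intro card_mono) (auto simp: fin finite_boundary_parents[OF F])
  also have "\<dots> \<le> (\<Sum>A\<in>MF F U. card (boundary_parents F A))"
    by (rule card_UN_le[OF fin])
  also have "\<dots> \<le> (\<Sum>A\<in>MF F U. 2)"
    by (intro sum_mono boundary_parents_factor[OF F]) (simp add: MF_def)
  finally show ?thesis by simp
qed

text \<open>Without context factors, the maximal factors covering \<open>U\<close> are forest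
  factors, each closed under children. Used in contrapositive form: a component that an edge leaves
  downwards is one of those counted by \<open>mir\<close>.\<close>

lemma well_formed_children:
  assumes F: "rooted_forest F" and U: "U \<subseteq> nodes F" and wf: "well_formed F U"
    and u: "u \<in> U" and v: "v \<in> children F u"
  shows "v \<in> U"
proof -
  obtain A where A: "A \<in> MF F U" "u \<in> A" using MF_covers[OF F U u] .
  then have "factor F A" "\<not> context_factor F A" "A \<subseteq> U"
    using wf by (auto simp: well_formed_def) (auto simp: MF_def)
  then obtain S where "forest_factor_at F S A"
    by (auto elim: factor_cases)
  then show ?thesis using forest_factor_at_children[OF F _ A(2) v] \<open>A \<subseteq> U\<close> by auto
qed

section \<open>Margins and components of a tree decomposition\<close>

text \<open>A walk from \<open>x\<close> through bags containing \<open>u\<close> could leave the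
  subtree of \<open>x\<close> only through the parent of \<open>x\<close>, whose bag misses
  \<open>u\<close> because \<open>u\<close> is not in the adhesion of \<open>x\<close>.\<close>

lemma mrg_top_of_connected:
  assumes T: "rooted_forest T" and con: "connected_in T {x \<in> nodes T. u \<in> bag x}"
    and x: "x \<in> nodes T" "u \<in> mrg T bag x" and y: "y \<in> nodes T" "u \<in> bag y"
  shows "y \<in> descendants T x"
proof -
  let ?S = "{x \<in> nodes T. u \<in> bag x}"
  have no_parent: "(x, w) \<notin> parent T" if "u \<in> bag w" for w
    using x that by (auto simp: mrg_def adh_def)
  have "(x, y) \<in> (Restr (adj T) ?S)\<^sup>*"
    using con x y by (auto simp: connected_in_def mrg_def)
  then show ?thesis
  proof (induction rule: rtrancl_induct)
    case base
    then show ?case using x by (simp add: descendants_refl)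
  next
    case (step w w')
    then show ?case
      using descendants_child[OF T, of w x w'] descendants_parent[OF T, of w x w'] no_parent
      by (auto simp: adj_def)
  qed
qed

text \<open>A highest node whose bag contains \<open>u\<close> has \<open>u\<close> in its margin.
  Two nodes with \<open>u\<close> in their margins are descendants of each other, hence
  equal.\<close>

lemma ex1_mrg:
  assumes T: "rooted_forest T" and con: "connected_in T {x \<in> nodes T. u \<in> bag x}"
    and ne: "\<exists>x\<in>nodes T. u \<in> bag x"
  shows "\<exists>!x. x \<in> nodes T \<and> u \<in> mrg T bag x"
proof -
  have "finite (parent T)" "acyclic (parent T)"
    using T by (auto simp: rooted_forest_def intro: finite_subset)
  \<comment> \<open>In the converse relation parents are the smaller elements, so a minimal node is
    a highest one.\<close>
  then have "wf ((parent T)\<inverse>)" by (rule finite_acyclic_wf_converse)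
  moreover obtain x0 where "x0 \<in> {x \<in> nodes T. u \<in> bag x}" using ne by auto
  ultimately obtain x where x: "x \<in> {x \<in> nodes T. u \<in> bag x}"
    and max: "\<And>y. (y, x) \<in> (parent T)\<inverse> \<Longrightarrow> y \<notin> {x \<in> nodes T. u \<in> bag x}"
    by (rule wfE_min) blast
  have "u \<in> mrg T bag x"
    using x max rooted_forest_nodes[OF T] by (auto simp: mrg_def adh_def)
  with x show ?thesis
    using mrg_top_of_connected[OF T con] descendants_antisym[OF T]
    by (intro ex1I[of _ x]) (auto simp: mrg_def)
qed

text \<open>Each vertex is in an edge and each edge in a bag, so the definite description in
  \<open>mn\<close> denotes.\<close>

lemma tree_decomposition_mn:
  assumes H: "hypergraph H" and D: "tree_decomposition H T bag" and u: "u \<in> hverts H"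
  shows "mn T bag u \<in> nodes T \<and> u \<in> mrg T bag (mn T bag u)"
    and "x \<in> nodes T \<Longrightarrow> u \<in> mrg T bag x \<Longrightarrow> mn T bag u = x"
proof -
  have T: "rooted_forest T" using D by (simp add: tree_decomposition_def rooted_tree_def)
  obtain e where "e \<in> hedges H" "u \<in> e" using H u by (auto simp: hypergraph_def)
  then have "\<exists>x\<in>nodes T. u \<in> bag x"
    using D unfolding tree_decomposition_def by blast
  then have ex1: "\<exists>!x. x \<in> nodes T \<and> u \<in> mrg T bag x"
    using D u by (intro ex1_mrg[OF T]) (auto simp: tree_decomposition_def)
  show "mn T bag u \<in> nodes T \<and> u \<in> mrg T bag (mn T bag u)"
    unfolding mn_def by (rule theI'[OF ex1])
  show "mn T bag u = x" if "x \<in> nodes T" "u \<in> mrg T bag x"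
    unfolding mn_def using ex1 that by (blast intro: the1_equality)
qed

text \<open>Turns membership in a component into a position in \<open>T\<close>, where
  \<open>path_nodes_descendants\<close> applies.\<close>

lemma in_cmp_iff:
  assumes "hypergraph H" "tree_decomposition H T bag" "u \<in> hverts H"
  shows "u \<in> cmp T bag y \<longleftrightarrow> mn T bag u \<in> descendants T y"
proof
  assume "u \<in> cmp T bag y"
  then obtain w where w: "w \<in> descendants T y" "u \<in> mrg T bag w" by (auto simp: cmp_def)
  then have "mn T bag u = w"
    using tree_decomposition_mn(2)[OF assms] by (simp add: descendants_def)
  then show "mn T bag u \<in> descendants T y" using w by simp
next
  assume "mn T bag u \<in> descendants T y"
  then show "u \<in> cmp T bag y"
    using tree_decomposition_mn(1)[OF assms] by (auto simp: cmp_def)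
qed

section \<open>Counting the stains that contain a node\<close>

lemma stain_cases:
  assumes H: "hypergraph H" and D: "tree_decomposition H T bag"
    and E: "elimination_forest H F" and x: "x \<in> nodes T"
    and u: "u \<in> hverts H" and stain: "x \<in> Stain T bag F u"
  shows "u \<in> bag x \<or> (\<exists>v\<in>bag x. (v, u) \<in> parent F)
    \<or> u \<in> boundary_parents F (cmp T bag x)
    \<or> (\<exists>y\<in>children T x. \<not> well_formed F (cmp T bag y)
          \<and> u \<in> boundary_parents F (cmp T bag y))"
proof (cases "mn T bag u = x")
  case True
  then show ?thesis using tree_decomposition_mn(1)[OF H D u] by (auto simp: mrg_def)
next
  case mnu: False
  have T: "rooted_forest T" using D by (simp add: tree_decomposition_def rooted_tree_def)
  have F: "rooted_forest F" and nF: "nodes F = hverts H"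
    using E by (auto simp: elimination_forest_def)
  obtain v where v: "v \<in> children F u" "x \<in> path_nodes T (mn T bag u) (mn T bag v)"
    using stain mnu by (auto simp: Stain_def)
  have vH: "v \<in> hverts H"
    using v(1) rooted_forest_nodes[OF F] nF by (auto simp: children_def)
  note cmp_u = in_cmp_iff[OF H D u] and cmp_v = in_cmp_iff[OF H D vH]
  note path = path_nodes_descendants[OF T v(2)]
  show ?thesis
  proof (cases "mn T bag v = x")
    case True
    then have "v \<in> bag x" using tree_decomposition_mn(1)[OF H D vH] by (auto simp: mrg_def)
    then show ?thesis using v(1) by (auto simp: children_def)
  next
    case False
    show ?thesis
    proof (cases "u \<in> cmp T bag x \<longleftrightarrow> v \<in> cmp T bag x")
      case False
      then show ?thesis using v(1) by (auto simp: boundary_parents_def)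
    next
      case True
      \<comment> \<open>Both ends of the path are on the same side of the subtree of
        \<open>x\<close>; as \<open>x\<close> is on the path and in its own subtree, that side is
        the inside.\<close>
      then have "mn T bag u \<in> descendants T x"
        using path[of x] cmp_u cmp_v descendants_refl[OF x] by blast
      then obtain y where y: "y \<in> children T x" "mn T bag u \<in> descendants T y"
        using strict_descendant_via_child[OF T] mnu by metis
      have "x \<notin> descendants T y"
        using y(1) not_descendant_of_child[OF T] by (auto simp: children_def)
      \<comment> \<open>If \<open>mn T bag v\<close> were below \<open>y\<close> too, the whole path
        would be, including \<open>x\<close>.\<close>
      then have uv: "u \<in> cmp T bag y" "v \<notin> cmp T bag y"
        using path[of y] y(2) cmp_u cmp_v by auto
      have "cmp T bag y \<subseteq> nodes F"
        using D nF by (auto simp: cmp_def mrg_def descendants_def tree_decomposition_def)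
      then have "\<not> well_formed F (cmp T bag y)"
        using well_formed_children[OF F] uv v(1) by metis
      then show ?thesis using uv v(1) y(1) by (auto simp: boundary_parents_def)
    qed
  qed
qed

lemma degree_SG_le:
  assumes "hypergraph H"
  shows "degree (SG H T bag F) (Inl x) \<le> card {u \<in> hverts H. x \<in> Stain T bag F u}"
proof -
  let ?U = "{u \<in> hverts H. x \<in> Stain T bag F u}"
  have fin: "finite ?U" using assms by (simp add: hypergraph_def)
  have "{e \<in> gedges (SG H T bag F). Inl x \<in> e} \<subseteq> (\<lambda>u. {Inl x, Inr u}) ` ?U"
    by (auto simp: SG_def)
  then show ?thesis
    unfolding degree_def by (rule surj_card_le[OF fin])
qed

text \<open>The vertices of the bag and their parents in \<open>F\<close> give at most
  \<open>2 * card (bag x)\<close>, parents being unique. Each component gives at most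
  \<open>2 * split T bag F\<close> upper ends; it is summed over \<open>x\<close> itself and the
  children counted by \<open>mir\<close>.\<close>

lemma card_stain_le:
  assumes H: "hypergraph H" and D: "tree_decomposition H T bag"
    and E: "elimination_forest H F" and x: "x \<in> nodes T"
  shows "card {u \<in> hverts H. x \<in> Stain T bag F u}
    \<le> 2 * card (bag x) + 2 * split T bag F + mir T bag F * (2 * split T bag F)"
proof -
  let ?s = "split T bag F"
  let ?bd = "\<lambda>y. boundary_parents F (cmp T bag y)"
  let ?Y = "{y \<in> children T x. \<not> well_formed F (cmp T bag y)}"
  let ?P = "\<Union>v\<in>bag x. parent F `` {v}"
  have T: "rooted_forest T" using D by (simp add: tree_decomposition_def rooted_tree_def)
  have F: "rooted_forest F" and nF: "nodes F = hverts H"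
    using E by (auto simp: elimination_forest_def)
  have finT: "finite (nodes T)" using T by (simp add: rooted_forest_def)
  have Y: "?Y \<subseteq> nodes T" using rooted_forest_nodes[OF T] by (auto simp: children_def)
  have finY: "finite ?Y" using finite_subset[OF Y finT] .
  have fin_bag: "finite (bag x)"
    using D H x by (auto simp: tree_decomposition_def hypergraph_def intro: finite_subset)
  have Pv: "finite (parent F `` {v}) \<and> card (parent F `` {v}) \<le> 1" for v
  proof -
    have "parent F `` {v} = {} \<or> (\<exists>w. parent F `` {v} = {w})"
      using F unfolding rooted_forest_def single_valued_def by blast
    then show ?thesis by auto
  qed
  have bd: "card (?bd y) \<le> 2 * ?s" if y: "y \<in> nodes T" for y
  proof -
    have "cmp T bag y \<subseteq> nodes F"
      using D nF by (auto simp: cmp_def mrg_def descendants_def tree_decomposition_def)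
    then have "card (?bd y) \<le> 2 * card (MF F (cmp T bag y))"
      by (rule card_boundary_parents_le[OF F])
    also have "card (MF F (cmp T bag y)) \<le> ?s"
      unfolding split_def using finT y by (intro Max_ge) auto
    finally show ?thesis by simp
  qed
  have "card {u \<in> hverts H. x \<in> Stain T bag F u} \<le> card (bag x \<union> ?P \<union> ?bd x \<union> (\<Union>y\<in>?Y. ?bd y))"
  proof (rule card_mono)
    show "{u \<in> hverts H. x \<in> Stain T bag F u} \<subseteq> bag x \<union> ?P \<union> ?bd x \<union> (\<Union>y\<in>?Y. ?bd y)"
    proof
      fix u assume "u \<in> {u \<in> hverts H. x \<in> Stain T bag F u}"
      then show "u \<in> bag x \<union> ?P \<union> ?bd x \<union> (\<Union>y\<in>?Y. ?bd y)"
        using stain_cases[OF H D E x, of u] by auto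
    qed
  qed (use fin_bag Pv finY finite_boundary_parents[OF F] in auto)
  also have "\<dots> \<le> card (bag x) + card ?P + card (?bd x) + card (\<Union>y\<in>?Y. ?bd y)"
    by (intro order_trans[OF card_Un_le] add_mono order_refl)
  also have "card ?P \<le> (\<Sum>v\<in>bag x. 1)"
    by (intro order_trans[OF card_UN_le[OF fin_bag]] sum_mono) (use Pv in blast)
  also have "card (\<Union>y\<in>?Y. ?bd y) \<le> (\<Sum>y\<in>?Y. 2 * ?s)"
    by (intro order_trans[OF card_UN_le[OF finY]] sum_mono bd) (use Y in auto)
  also have "\<dots> = card ?Y * (2 * ?s)" by simp
  also have "card ?Y \<le> mir T bag F"
    unfolding mir_def using finT x by (intro Max_ge) auto
  finally show ?thesis using bd[OF x] by simp
qed

theorem theorem55: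
  fixes f :: "'v hypergraph \<Rightarrow> 'v set \<Rightarrow> real"
  assumes "manageable f"
  shows "\<exists>h :: nat \<Rightarrow> nat \<Rightarrow> real \<Rightarrow> nat \<Rightarrow> nat.
    \<forall>(H :: 'v hypergraph) (T :: 't rforest) (bag :: 't \<Rightarrow> 'v set) (F :: 'v rforest).
      hypergraph H \<longrightarrow> tree_decomposition H T bag \<longrightarrow> elimination_forest H F \<longrightarrow>
      (\<forall>x\<in>nodes T. degree (SG H T bag F) (Inl x)
         \<le> h (split T bag F) (mir T bag F) (fwidth f H T bag) (rank H))"
proof -
  obtain \<beta> where \<beta>: "\<And>H U k. hypergraph H \<Longrightarrow> U \<subseteq> hverts H \<Longrightarrow> f H U \<le> real k
      \<Longrightarrow> card U \<le> \<beta> k (rank H)"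
    using assms unfolding manageable_def by metis
  \<comment> \<open>The function \<beta> takes a natural number as threshold, so the real width is
    rounded up; it then turns the width into a bound on the size of a bag.\<close>
  let ?h = "\<lambda>s m w r. 2 * \<beta> (nat \<lceil>w\<rceil>) r + 2 * s + m * (2 * s)"
  show ?thesis
  proof (rule exI[of _ ?h], intro allI impI ballI)
    fix H :: "'v hypergraph" and T :: "'t rforest" and bag :: "'t \<Rightarrow> 'v set"
      and F :: "'v rforest" and x
    assume H: "hypergraph H" and D: "tree_decomposition H T bag"
      and E: "elimination_forest H F" and x: "x \<in> nodes T"
    have "finite (nodes T)"
      using D by (simp add: tree_decomposition_def rooted_tree_def rooted_forest_def)
    then have "f H (bag x) \<le> fwidth f H T bag"
      unfolding fwidth_def using x by (intro Max_ge) auto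
    then have "f H (bag x) \<le> real (nat \<lceil>fwidth f H T bag\<rceil>)"
      using real_nat_ceiling_ge order_trans by blast
    moreover have "bag x \<subseteq> hverts H" using D x by (simp add: tree_decomposition_def)
    ultimately have "card (bag x) \<le> \<beta> (nat \<lceil>fwidth f H T bag\<rceil>) (rank H)"
      by (intro \<beta>[OF H])
    then show "degree (SG H T bag F) (Inl x)
        \<le> ?h (split T bag F) (mir T bag F) (fwidth f H T bag) (rank H)"
      using degree_SG_le[OF H, of T bag F x] card_stain_le[OF H D E x] by linarith
  qed
qed

end
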